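(* Let $p,q$ be positive integers with $\frac{p}{q}>2$ and $q\nmid p$. Then $\theta(K_{p/q})>1$.
   Context: For integers $p\ge 2q\ge 2$, the circular complete graph $K_{p/q}$ has vertices $v_0,\ldots,v_{p-1}$ with $v_iv_j$ an edge iff $q\le|i-j|\le p-q$. For a positive integer $k$, $G^{k}$ has vertex set $V(G)$, with $u,v$ adjacent iff there is a walk of length $k$ between them in $G$. $S_t(G)$ replaces each edge by a path with exactly $t-1$ inner vertices, and $G^{\frac{2r+1}{2s+1}}:=(S_{2s+1}(G))^{2r+1}$ for non-negative integers $r,s$. $og(G)$ is the odd girth. For a non-bipartite graph $G$, $\theta(G):=\sup\{\frac{2r+1}{2s+1}: r,s\ge 0 \text{ integers},\ \chi(G^{\frac{2r+1}{2s+1}})\le\chi(G),\ \frac{2r+1}{2s+1}<og(G)\}$. *)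

theory Defs
  imports
    "Graph_Theory.Pair_Digraph"
    "HOL-Library.Extended_Real"
begin

text \<open>
  As in the Graph_Theory library, an undirected graph is a symmetric digraph without parallel
  arcs; a finite simple graph is one satisfying the locale \<^locale>\<open>pair_graph\<close>.
\<close>

definition circular_complete_graph :: "nat \<Rightarrow> nat \<Rightarrow> nat pair_pre_digraph" where
  "circular_complete_graph p q =
    \<lparr> pverts = {..<p},
      parcs = {(i, j). i < p \<and> j < p \<and>
        int q \<le> \<bar>int i - int j\<bar> \<and> \<bar>int i - int j\<bar> \<le> int p - int q} \<rparr>"

text \<open>
  A closed walk of length \<open>k\<close> gives a loop of the power; a power with a loop has no proper
  colouring.
\<close>

definition graph_power :: "'a pair_pre_digraph \<Rightarrow> nat \<Rightarrow> 'a pair_pre_digraph" where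
  "graph_power G k =
    \<lparr> pverts = pverts G,
      parcs = {(u, v). \<exists>w. pre_digraph.awalk (with_proj G) u w v \<and> length w = k} \<rparr>"

text \<open>
  \<open>subdiv_point t u v i\<close> is the \<open>i\<close>-th vertex (\<open>0 \<le> i \<le> t\<close>) of the path of length \<open>t\<close> that replaces
  the edge \<open>uv\<close>, counted from \<open>u\<close>. An inner vertex is named by its distances to both ends of the
  path, so that the two orientations of an edge produce the same path:
  \<open>subdiv_point t u v i = subdiv_point t v u (t - i)\<close>.
\<close>

datatype 'a subdiv_vertex = Orig 'a | Inner "('a \<times> nat) set"

definition subdiv_point :: "nat \<Rightarrow> 'a \<Rightarrow> 'a \<Rightarrow> nat \<Rightarrow> 'a subdiv_vertex" where
  "subdiv_point t u v i =
    (if i = 0 then Orig u else if i = t then Orig v else Inner {(u, i), (v, t - i)})"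

definition subdivide :: "nat \<Rightarrow> 'a pair_pre_digraph \<Rightarrow> 'a subdiv_vertex pair_pre_digraph" where
  "subdivide t G =
    \<lparr> pverts = Orig ` pverts G \<union> {subdiv_point t u v i | u v i. (u, v) \<in> parcs G \<and> 0 < i \<and> i < t},
      parcs = (\<Union>(u, v) \<in> parcs G. \<Union>i<t.
        {(subdiv_point t u v i, subdiv_point t u v (Suc i)),
         (subdiv_point t u v (Suc i), subdiv_point t u v i)}) \<rparr>"

text \<open>\<open>frac_power G r s\<close> is the fractional power of \<open>G\<close> with exponent \<open>(2r+1)/(2s+1)\<close>.\<close>

definition frac_power :: "'a pair_pre_digraph \<Rightarrow> nat \<Rightarrow> nat \<Rightarrow> 'a subdiv_vertex pair_pre_digraph" where
  "frac_power G r s = graph_power (subdivide (2 * s + 1) G) (2 * r + 1)"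

definition proper_colouring :: "'a pair_pre_digraph \<Rightarrow> nat \<Rightarrow> ('a \<Rightarrow> nat) \<Rightarrow> bool" where
  "proper_colouring G k c \<longleftrightarrow> c ` pverts G \<subseteq> {..<k} \<and> (\<forall>(u, v) \<in> parcs G. c u \<noteq> c v)"

definition chromatic_number :: "'a pair_pre_digraph \<Rightarrow> enat" where
  "chromatic_number G = Inf {enat k | k. \<exists>c. proper_colouring G k c}"

text \<open>
  A symmetric digraph has the directed cycles \<open>u, v, u\<close>, which are not cycles of the undirected graph;
  they have even length and so do not matter here. The value is \<open>\<infinity>\<close> for bipartite graphs.
\<close>

definition odd_girth :: "'a pair_pre_digraph \<Rightarrow> enat" where
  "odd_girth G = Inf {enat (length c) | c. pre_digraph.cycle (with_proj G) c \<and> odd (length c)}"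

text \<open>Meant for non-bipartite \<open>G\<close>, for which the set is nonempty and bounded by the odd girth.\<close>

definition theta :: "'a pair_pre_digraph \<Rightarrow> ereal" where
  "theta G = Sup {ereal (real (2 * r + 1) / real (2 * s + 1)) | r s.
     chromatic_number (frac_power G r s) \<le> chromatic_number G \<and>
     ereal (real (2 * r + 1) / real (2 * s + 1)) < ereal_of_enat (odd_girth G)}"

lemma subdiv_point_swap:
  assumes "i \<le> t" "0 < t"
  shows "subdiv_point t u v i = subdiv_point t v u (t - i)"
  using assms by (auto simp: subdiv_point_def)

lemma pair_graph_circular_complete_graph:
  assumes "0 < q"
  shows "pair_graph (circular_complete_graph p q)"
proof
  have "parcs (circular_complete_graph p q) \<subseteq> {..<p} \<times> {..<p}"
    by (auto simp: circular_complete_graph_def)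
  then show "finite (parcs (circular_complete_graph p q))"
    by (rule finite_subset) simp
  show "symmetric (with_proj (circular_complete_graph p q))"
    by (auto simp: symmetric_def circular_complete_graph_def sym_def abs_minus_commute)
qed (use assms in \<open>auto simp: circular_complete_graph_def\<close>)

lemma card_subdivision_path:
  assumes "u \<noteq> v"
  shows "card (subdiv_point t u v ` {0<..<t}) = t - 1"
proof -
  have "inj_on (subdiv_point t u v) {0<..<t}"
    using assms by (auto simp: inj_on_def subdiv_point_def doubleton_eq_iff)
  then show ?thesis by (simp add: card_image)
qed

lemma disjoint_subdivision_paths:
  assumes "{u, v} \<noteq> {x, y}"
  shows "subdiv_point t u v ` {0<..<t} \<inter> subdiv_point t x y ` {0<..<t} = {}"
  using assms by (auto simp: subdiv_point_def doubleton_eq_iff)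

end

theory Submission
  imports Defs
begin

text \<open>
  Place the vertices of \<open>K\<^bsub>p/q\<^esub>\<close> at the points \<open>i/p\<close> of the circle \<open>\<real>/\<int>\<close>; adjacent vertices then differ by
  \<open>1/2\<close> up to an error of at most \<open>1/2 - q/p\<close>. As \<open>2s+1\<close> is odd, the path replacing an edge can be
  drawn with equal steps, each of which is \<open>1/2\<close> up to \<open>(1/2 - q/p)/(2s+1)\<close>. The ends of a walk of
  length \<open>2r+1\<close> therefore differ by \<open>1/2\<close> up to \<open>(2r+1)(1/2 - q/p)/(2s+1)\<close>, and as long as this is at
  most \<open>1/2 - 1/n\<close> they lie in different arcs when the circle is cut into \<open>n\<close> half-open arcs of length
  \<open>1/n\<close>. For \<open>n = \<lceil>p/q\<rceil> = \<chi>(K\<^bsub>p/q\<^esub>)\<close> we have \<open>1/n < q/p\<close> because \<open>q\<close> does not divide \<open>p\<close>, so \<open>r = s+1\<close> is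
  possible for large \<open>s\<close>.
\<close>

section \<open>Chromatic number and odd girth of circular complete graphs\<close>

text \<open>Seen from the least element of \<open>J\<close>, every other element lies at distance
  below \<open>q\<close> or above \<open>p - q\<close>. Folding the far range back by
  \<open>p - q\<close> puts everything into \<open>q\<close> slots, and two elements sharing a slot
  would be adjacent.\<close>

lemma card_independent_circular_complete_graph:
  assumes "2 * q \<le> p" "0 < q" and J: "J \<subseteq> {..<p}"
    and indep: "\<And>x y. x \<in> J \<Longrightarrow> y \<in> J \<Longrightarrow> (x, y) \<notin> parcs (circular_complete_graph p q)"
  shows "card J \<le> q"
proof (cases "J = {}")
  case False
  define a where "a = Min J"
  have fin: "finite J" using J finite_subset by blast
  have a: "a \<in> J" and a_le: "\<And>x. x \<in> J \<Longrightarrow> a \<le> x"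
    using fin False by (auto simp: a_def)
  define g where "g x = (if x - a < q then x - a else x - a - (p - q))" for x
  have far: "y - x < q \<or> p - q < y - x" if "x \<in> J" "y \<in> J" "x \<le> y" for x y
    using indep[of x y] that J assms(1) by (auto simp: circular_complete_graph_def)
  have "inj_on g J"
  proof (rule inj_onI)
    fix x y assume xy: "x \<in> J" "y \<in> J" "g x = g y"
    \<comment> \<open>A distance of exactly \<open>p - q\<close> is an edge, since
      \<open>q \<le> p - q\<close>; the truncated difference is 0, which is not \<open>p - q\<close>
      because \<open>q\<close> is positive.\<close>
    have "y - x \<noteq> p - q" "x - y \<noteq> p - q"
      using far[of x y] far[of y x] xy assms(1,2) by (cases "x \<le> y"; auto)+
    moreover obtain x' y' where x'y': "x = a + x'" "y = a + y'"
      using a_le xy le_Suc_ex by metis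
    moreover have "x' < q \<or> p - q < x'" "y' < q \<or> p - q < y'"
      using far[OF a xy(1)] far[OF a xy(2)] x'y' by simp_all
    ultimately show "x = y"
      using xy(3) by (cases "x' < q"; cases "y' < q") (simp_all add: g_def)
  qed
  moreover have "g ` J \<subseteq> {..<q}"
  proof
    fix z assume "z \<in> g ` J"
    then obtain x where x: "x \<in> J" "z = g x" by auto
    then have "x < p" using J by auto
    then show "z \<in> {..<q}" using x assms(1,2) by (auto simp: g_def)
  qed
  ultimately show ?thesis
    using card_inj_on_le[of g J "{..<q}"] by simp
qed simp

text \<open>Colour classes are independent, so each of the \<open>k\<close> classes holds at most
  \<open>q\<close> of the \<open>p\<close> vertices.\<close>

lemma proper_colouring_circular_complete_graph_bound:
  assumes "2 * q \<le> p" "0 < q" and c: "proper_colouring (circular_complete_graph p q) k c"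
  shows "p \<le> k * q"
proof -
  define F where "F i = {x \<in> {..<p}. c x = i}" for i
  have "card (F i) \<le> q" for i
    by (rule card_independent_circular_complete_graph[OF assms(1,2)])
      (use c in \<open>auto simp: F_def proper_colouring_def\<close>)
  then have "(\<Sum>i<k. card (F i)) \<le> (\<Sum>i<k. q)" by (intro sum_mono)
  moreover have "(\<Union>i<k. F i) = {..<p}"
    using c by (auto simp: F_def proper_colouring_def circular_complete_graph_def)
  then have "p \<le> (\<Sum>i<k. card (F i))"
    using card_UN_le[of "{..<k}" F] by simp
  ultimately show ?thesis by simp
qed

text \<open>Only a loop could give an odd cycle shorter than 3. This bound keeps the exponent chosen
  in the main proof below the odd girth.\<close>

lemma odd_girth_ge_3:
  assumes "\<And>u. (u, u) \<notin> parcs G"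
  shows "3 \<le> odd_girth G"
  unfolding odd_girth_def
proof (rule Inf_greatest)
  fix x assume "x \<in> {enat (length c) |c. pre_digraph.cycle (with_proj G) c \<and> odd (length c)}"
  then obtain c where x: "x = enat (length c)" and c: "pre_digraph.cycle (with_proj G) c"
    and odd: "odd (length c)" by auto
  have "length c \<noteq> 1"
  proof
    assume "length c = 1"
    then obtain e where e: "c = [e]" by (auto simp: length_Suc_conv)
    then show False
      using c assms[of "fst e"]
      by (cases e) (auto simp: pre_digraph.cycle_def pre_digraph.awalk_def pre_digraph.cas.simps)
  qed
  with odd have "3 \<le> length c" by (auto elim!: oddE)
  then show "3 \<le> x" by (simp add: x numeral_eq_enat)
qed

section \<open>Drawing the subdivision on the circle\<close>

text \<open>For distinct \<open>u, v < p\<close> this is the length of the arc from \<open>u/p\<close> to \<open>v/p\<close> in the positive direction.\<close>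

definition arc_gap :: "nat \<Rightarrow> nat \<Rightarrow> nat \<Rightarrow> real" where
  "arc_gap p u v = real v / real p - real u / real p + (if v < u then 1 else 0)"

text \<open>Equals \<open>(s + arc_gap p u v) / (2 * s + 1)\<close>: the whole path makes
  \<open>s\<close> full turns and then covers the gap, which keeps each step near 1/2.\<close>

definition path_step :: "nat \<Rightarrow> nat \<Rightarrow> nat \<Rightarrow> nat \<Rightarrow> real" where
  "path_step p s u v = 1/2 + (arc_gap p u v - 1/2) / real (2 * s + 1)"

definition path_pos :: "nat \<Rightarrow> nat \<Rightarrow> nat \<Rightarrow> nat \<Rightarrow> nat \<Rightarrow> real" where
  "path_pos p s u v k = real u / real p + real k * path_step p s u v"

lemma arc_gap_swap: "u \<noteq> v \<Longrightarrow> arc_gap p v u = 1 - arc_gap p u v"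
  by (auto simp: arc_gap_def)

lemma path_step_swap: "u \<noteq> v \<Longrightarrow> path_step p s v u = 1 - path_step p s u v"
  by (simp only: path_step_def arc_gap_swap) (simp add: diff_divide_distrib)

lemma path_step_total: "real (2 * s + 1) * path_step p s u v = real s + arc_gap p u v"
proof -
  have "real (2 * s + 1) * ((arc_gap p u v - 1/2) / real (2 * s + 1)) = arc_gap p u v - 1/2"
    by (simp only: times_divide_eq_right) (rule nonzero_mult_div_cancel_left, simp)
  then show ?thesis unfolding path_step_def distrib_left by (simp add: add_divide_distrib)
qed

lemma path_pos_end: "path_pos p s u v (2 * s + 1) - real v / real p \<in> \<int>"
proof -
  have "path_pos p s u v (2 * s + 1) - real v / real p = real (s + (if v < u then 1 else 0))"
    unfolding path_pos_def path_step_total by (simp add: arc_gap_def)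
  then show ?thesis by (simp only: Ints_of_nat)
qed

text \<open>Reversing the edge turns the step \<open>d\<close> into \<open>1 - d\<close>, which is
  \<open>-d\<close> modulo 1, so both orientations draw the same points on the circle.\<close>

lemma path_pos_swap:
  assumes "u \<noteq> v" "k \<le> 2 * s + 1"
  shows "path_pos p s v u (2 * s + 1 - k) - path_pos p s u v k \<in> \<int>"
proof -
  have "path_pos p s v u (2 * s + 1 - k) - path_pos p s u v k =
    - (path_pos p s u v (2 * s + 1) - real v / real p) + real (2 * s + 1 - k)"
    unfolding path_pos_def path_step_swap[OF assms(1)] of_nat_diff[OF assms(2)]
    by (simp only: algebra_simps mult_1)
  moreover have "\<dots> \<in> \<int>"
    by (intro Ints_add Ints_minus Ints_of_nat path_pos_end)
  ultimately show ?thesis by simp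
qed

text \<open>An inner vertex fixes its path and index up to reversal. An original vertex may end many
  paths, but each of them places \<open>x\<close> at \<open>x/p\<close> modulo 1.\<close>

lemma path_pos_well_defined:
  assumes eq: "subdiv_point (2 * s + 1) u v k = subdiv_point (2 * s + 1) u' v' k'"
    and k: "k \<le> 2 * s + 1" "k' \<le> 2 * s + 1" and ne: "u \<noteq> v" "u' \<noteq> v'"
  shows "path_pos p s u v k - path_pos p s u' v' k' \<in> \<int>"
proof -
  have orig: "path_pos p s a b j - real x / real p \<in> \<int>"
    if "subdiv_point (2 * s + 1) a b j = Orig x" for a b j x
    using that path_pos_end[of p s a b]
    by (auto simp: subdiv_point_def path_pos_def split: if_splits)
  show ?thesis
  proof (cases "subdiv_point (2 * s + 1) u v k")
    case (Orig x)
    then show ?thesis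
      using Ints_diff[OF orig[of u v k x] orig[of u' v' k' x]] eq by simp
  next
    case (Inner X)
    then have "{(u, k), (v, 2 * s + 1 - k)} = {(u', k'), (v', 2 * s + 1 - k')}"
      using eq by (auto simp: subdiv_point_def split: if_splits)
    then consider "u = u'" "v = v'" "k = k'" | "u = v'" "v = u'" "k = 2 * s + 1 - k'"
      by (auto simp: doubleton_eq_iff)
    then show ?thesis
      using path_pos_swap[of u' v' k' s p] k ne by cases auto
  qed
qed

text \<open>The choice of a representing path only affects the value by an integer.\<close>

definition circle_pos :: "nat \<Rightarrow> nat \<Rightarrow> nat subdiv_vertex \<Rightarrow> real" where
  "circle_pos p s x =
    (SOME y. \<exists>u v k. u \<noteq> v \<and> k \<le> 2 * s + 1 \<and> x = subdiv_point (2 * s + 1) u v k \<and> y = path_pos p s u v k)"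

lemma circle_pos_subdiv_point:
  assumes "u \<noteq> v" "k \<le> 2 * s + 1"
  shows "circle_pos p s (subdiv_point (2 * s + 1) u v k) - path_pos p s u v k \<in> \<int>"
proof -
  let ?x = "subdiv_point (2 * s + 1) u v k"
  let ?P = "\<lambda>y. \<exists>u v k. u \<noteq> v \<and> k \<le> 2 * s + 1 \<and> ?x = subdiv_point (2 * s + 1) u v k \<and> y = path_pos p s u v k"
  have "?P (path_pos p s u v k)"
    using assms by (intro exI[of _ u] exI[of _ v] exI[of _ k] conjI refl)
  then have "?P (circle_pos p s ?x)" unfolding circle_pos_def by (rule someI[of ?P])
  then obtain u' v' k' where u': "u' \<noteq> v'" "k' \<le> 2 * s + 1" "?x = subdiv_point (2 * s + 1) u' v' k'"
    and pos: "circle_pos p s ?x = path_pos p s u' v' k'" by (elim exE conjE)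
  show ?thesis
    unfolding pos by (rule path_pos_well_defined[OF u'(3)[symmetric] u'(2) assms(2) u'(1) assms(1)])
qed

text \<open>Adjacency keeps the arc gap between \<open>q/p\<close> and \<open>1 - q/p\<close> in
  either direction; its deviation from 1/2 is then shared among \<open>2 * s + 1\<close>
  steps.\<close>

lemma path_step_error:
  assumes "(u, v) \<in> parcs (circular_complete_graph p q)" "0 < p"
  shows "\<bar>path_step p s u v - 1/2\<bar> \<le> (1/2 - real q / real p) / real (2 * s + 1)"
proof -
  have *: "u < p" "v < p" "int q \<le> \<bar>int u - int v\<bar>" "\<bar>int u - int v\<bar> \<le> int p - int q"
    using assms(1) by (auto simp: circular_complete_graph_def)
  have "real q \<le> \<bar>real u - real v\<bar>" "\<bar>real u - real v\<bar> \<le> real p - real q"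
    using *(3,4) by linarith+
  then have "real q / real p \<le> \<bar>real u - real v\<bar> / real p"
    "\<bar>real u - real v\<bar> / real p \<le> (real p - real q) / real p"
    by (simp_all add: divide_right_mono)
  moreover have "\<bar>real u - real v\<bar> / real p = \<bar>real u / real p - real v / real p\<bar>"
    by (simp add: diff_divide_distrib[symmetric])
  moreover have "(real p - real q) / real p = 1 - real q / real p"
    using assms(2) by (simp add: diff_divide_distrib)
  moreover have "arc_gap p u v = real v / real p - real u / real p \<and> real u / real p \<le> real v / real p \<or>
      arc_gap p u v = real v / real p - real u / real p + 1 \<and> real v / real p < real u / real p"
    using assms(2) by (simp add: arc_gap_def divide_less_cancel divide_le_cancel)
  ultimately have "\<bar>arc_gap p u v - 1/2\<bar> \<le> 1/2 - real q / real p"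
    by linarith
  then show ?thesis
    by (simp add: path_step_def divide_right_mono del: of_nat_Suc of_nat_add)
qed

lemma circle_pos_arc:
  assumes "(x, y) \<in> parcs (subdivide (2 * s + 1) (circular_complete_graph p q))" "0 < p" "0 < q"
  shows "\<exists>m::int. \<bar>circle_pos p s y - circle_pos p s x - of_int m - 1/2\<bar>
    \<le> (1/2 - real q / real p) / real (2 * s + 1)"
proof -
  let ?t = "2 * s + 1" and ?e = "(1/2 - real q / real p) / real (2 * s + 1)"
  obtain u v i where uv: "(u, v) \<in> parcs (circular_complete_graph p q)" and i: "i < ?t"
    and xy: "(x, y) = (subdiv_point ?t u v i, subdiv_point ?t u v (Suc i)) \<or>
      (x, y) = (subdiv_point ?t u v (Suc i), subdiv_point ?t u v i)"
    using assms(1) unfolding subdivide_def by auto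
  have ne: "u \<noteq> v" using uv assms(3) by (auto simp: circular_complete_graph_def)
  obtain a where a: "circle_pos p s (subdiv_point ?t u v i) - path_pos p s u v i = of_int a"
    using circle_pos_subdiv_point[OF ne, of i s p] i by (auto elim!: Ints_cases)
  obtain b where b: "circle_pos p s (subdiv_point ?t u v (Suc i)) - path_pos p s u v (Suc i) = of_int b"
    using circle_pos_subdiv_point[OF ne, of "Suc i" s p] i by (auto elim!: Ints_cases)
  have step: "path_pos p s u v (Suc i) = path_pos p s u v i + path_step p s u v"
    by (simp add: path_pos_def algebra_simps)
  note err = path_step_error[OF uv assms(2), of s]
  from xy show ?thesis
  proof
    assume "(x, y) = (subdiv_point ?t u v i, subdiv_point ?t u v (Suc i))"
    then have "circle_pos p s y - circle_pos p s x - of_int (b - a) - 1/2 = path_step p s u v - 1/2"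
      using a b step by simp
    then show ?thesis using err by metis
  next
    assume "(x, y) = (subdiv_point ?t u v (Suc i), subdiv_point ?t u v i)"
    \<comment> \<open>The extra -1 adds a full turn, so that the backward step \<open>-d\<close>
      becomes \<open>1 - d\<close>, which is again near 1/2.\<close>
    then have "circle_pos p s y - circle_pos p s x - of_int (a - b - 1) - 1/2 = - (path_step p s u v - 1/2)"
      using a b step by simp
    then show ?thesis using err by (metis abs_minus_cancel)
  qed
qed

lemma circle_pos_walk:
  assumes "set w \<subseteq> parcs (subdivide (2 * s + 1) (circular_complete_graph p q))"
    and "pre_digraph.cas (with_proj (subdivide (2 * s + 1) (circular_complete_graph p q))) x w y"
    and "0 < p" "0 < q"
  shows "\<exists>m::int. \<bar>circle_pos p s y - circle_pos p s x - of_int m - real (length w) / 2\<bar>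
    \<le> real (length w) * ((1/2 - real q / real p) / real (2 * s + 1))"
  using assms(1,2)
proof (induction w arbitrary: x)
  case Nil
  then show ?case by (auto simp: pre_digraph.cas.simps intro!: exI[of _ 0])
next
  case (Cons a w)
  define e where "e = (1/2 - real q / real p) / real (2 * s + 1)"
  obtain z where a: "a = (x, z)"
    and z: "pre_digraph.cas (with_proj (subdivide (2 * s + 1) (circular_complete_graph p q))) z w y"
    using Cons.prems(2) by (cases a) (auto simp: pre_digraph.cas.simps)
  obtain m where m: "\<bar>circle_pos p s y - circle_pos p s z - of_int m - real (length w) / 2\<bar>
      \<le> real (length w) * e"
    using Cons.IH[OF _ z] Cons.prems(1) by (auto simp: e_def)
  obtain k where k: "\<bar>circle_pos p s z - circle_pos p s x - of_int k - 1/2\<bar> \<le> e"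
    using circle_pos_arc[of x z s p q] Cons.prems(1) a assms(3,4) by (auto simp: e_def)
  have "\<bar>circle_pos p s y - circle_pos p s x - of_int (m + k) - real (length (a # w)) / 2\<bar>
      \<le> real (length (a # w)) * e"
    using m k by (simp add: algebra_simps add_divide_distrib)
  then show ?case unfolding e_def by blast
qed

section \<open>Colouring the fractional power\<close>

lemma floor_frac_eq_imp_close:
  fixes a b :: real
  assumes "\<lfloor>real n * frac a\<rfloor> = \<lfloor>real n * frac b\<rfloor>" "0 < n"
  shows "\<bar>frac a - frac b\<bar> < 1 / real n"
proof -
  have "\<bar>real n * frac a - real n * frac b\<bar> < 1" using assms(1) by linarith
  then have "real n * \<bar>frac a - frac b\<bar> < 1"
    by (simp add: right_diff_distrib[symmetric] abs_mult)
  then show ?thesis using assms(2) by (simp add: field_simps)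
qed

lemma proper_colouring_frac_power:
  assumes "0 < p" "0 < q" "0 < n"
    and le: "real (2 * r + 1) * ((1/2 - real q / real p) / real (2 * s + 1)) \<le> 1/2 - 1 / real n"
  shows "proper_colouring (frac_power (circular_complete_graph p q) r s) n
    (\<lambda>x. nat \<lfloor>real n * frac (circle_pos p s x)\<rfloor>)"
  unfolding proper_colouring_def
proof (intro conjI)
  have "nat \<lfloor>real n * frac a\<rfloor> < n" for a :: real
  proof -
    have "real n * frac a < real n * 1"
      using assms(3) by (intro mult_strict_left_mono) (auto simp: frac_lt_1)
    then show ?thesis using assms(3) by (simp add: nat_less_iff floor_less_iff)
  qed
  then show "(\<lambda>x. nat \<lfloor>real n * frac (circle_pos p s x)\<rfloor>) `
      pverts (frac_power (circular_complete_graph p q) r s) \<subseteq> {..<n}" by auto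
  show "\<forall>(x, y) \<in> parcs (frac_power (circular_complete_graph p q) r s).
      nat \<lfloor>real n * frac (circle_pos p s x)\<rfloor> \<noteq> nat \<lfloor>real n * frac (circle_pos p s y)\<rfloor>"
  proof (intro ballI case_prodI2 notI)
    fix e x y
    assume xy: "e \<in> parcs (frac_power (circular_complete_graph p q) r s)" "e = (x, y)"
    assume "nat \<lfloor>real n * frac (circle_pos p s x)\<rfloor> = nat \<lfloor>real n * frac (circle_pos p s y)\<rfloor>"
    then have "\<lfloor>real n * frac (circle_pos p s x)\<rfloor> = \<lfloor>real n * frac (circle_pos p s y)\<rfloor>"
      by (simp add: eq_nat_nat_iff)
    then have close: "\<bar>frac (circle_pos p s x) - frac (circle_pos p s y)\<bar> < 1 / real n"
      using floor_frac_eq_imp_close assms(3) by blast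
    obtain w where w: "length w = 2 * r + 1"
      "set w \<subseteq> parcs (subdivide (2 * s + 1) (circular_complete_graph p q))"
      "pre_digraph.cas (with_proj (subdivide (2 * s + 1) (circular_complete_graph p q))) x w y"
      using xy by (auto simp: frac_power_def graph_power_def pre_digraph.awalk_def)
    obtain m :: int where "\<bar>circle_pos p s y - circle_pos p s x - of_int m - real (2 * r + 1) / 2\<bar>
        \<le> real (2 * r + 1) * ((1/2 - real q / real p) / real (2 * s + 1))"
      using circle_pos_walk[OF w(2,3) assms(1,2)] w(1) by auto
    also note le
    finally have walk: "\<bar>circle_pos p s y - circle_pos p s x - of_int m - real (2 * r + 1) / 2\<bar>
        \<le> 1/2 - 1 / real n" .
    \<comment> \<open>\<open>M\<close> collects all integer parts, including the \<open>r\<close>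
      full turns in \<open>(2 * r + 1) / 2\<close>; only the half turn remains.\<close>
    define M where "M = m + int r - \<lfloor>circle_pos p s y\<rfloor> + \<lfloor>circle_pos p s x\<rfloor>"
    have "circle_pos p s y - circle_pos p s x - of_int m - real (2 * r + 1) / 2 =
      frac (circle_pos p s y) - frac (circle_pos p s x) - of_int M - 1/2"
      by (simp add: M_def frac_def field_simps)
    \<comment> \<open>Together the bounds give \<open>\<bar>M + 1/2\<bar> < 1/2\<close>, impossible
      for an integer. The case \<open>x = y\<close> is included, so loops of the power are excluded
      too.\<close>
    with walk close have "of_int M < (0::real)" "of_int M > (-1::real)" by linarith+
    then show False by simp
  qed
qed

theorem theorem4p2:
  fixes p q :: nat
  assumes "0 < p" and "0 < q"
    and "real p / real q > 2"
    and "\<not> q dvd p"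
  shows "theta (circular_complete_graph p q) > 1"
proof -
  define n where "n = p div q + 1"
  define A where "A = 1/2 - real q / real p"
  define B where "B = 1/2 - 1 / real n"
  have "2 * real q < real p" using assms(2,3) by (simp add: field_simps)
  then have pq: "2 * q \<le> p" by linarith
  have n: "0 < n" by (simp add: n_def)
  have "p < n * q"
    using assms(2) by (simp add: n_def dividend_less_div_times)
  then have "real p < real n * real q" by (metis of_nat_less_iff of_nat_mult)
  then have AB: "A < B" using n assms(1) by (simp add: A_def B_def field_simps)
  \<comment> \<open>The goal \<open>(2 * s + 3) * A \<le> (2 * s + 1) * B\<close> amounts to
    \<open>2 * A \<le> (2 * s + 1) * (B - A)\<close>, true for large \<open>s\<close> as
    \<open>A < B\<close>.\<close>
  obtain s0 :: nat where "2 * A / (B - A) \<le> real s0" using real_arch_simple by blast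
  then have s0: "2 * A \<le> real s0 * (B - A)" using AB by (simp add: pos_divide_le_eq)
  \<comment> \<open>The successor ensures \<open>s \<ge> 1\<close>: for \<open>s = 0\<close> the
    exponent would be exactly 3, not below it.\<close>
  define s where "s = Suc s0"
  have "real s0 * (B - A) \<le> real (2 * s + 1) * (B - A)"
    using AB by (intro mult_right_mono) (auto simp: s_def)
  with s0 have "real (2 * (s + 1) + 1) * A \<le> B * real (2 * s + 1)"
    by (simp add: algebra_simps)
  then have "real (2 * (s + 1) + 1) * (A / real (2 * s + 1)) \<le> B"
    by (simp add: pos_divide_le_eq del: of_nat_Suc of_nat_add)
  then have "\<exists>c. proper_colouring (frac_power (circular_complete_graph p q) (s + 1) s) n c"
    using proper_colouring_frac_power[OF assms(1,2) n, of "s + 1" s] unfolding A_def B_def by blast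
  then have "chromatic_number (frac_power (circular_complete_graph p q) (s + 1) s) \<le> enat n"
    unfolding chromatic_number_def by (intro Inf_lower) auto
  also have "enat n \<le> chromatic_number (circular_complete_graph p q)"
    unfolding chromatic_number_def
  proof (rule Inf_greatest)
    fix x assume "x \<in> {enat k |k. \<exists>c. proper_colouring (circular_complete_graph p q) k c}"
    then obtain k where x: "x = enat k" and "p \<le> k * q"
      using proper_colouring_circular_complete_graph_bound[OF pq assms(2)] by auto
    \<comment> \<open>Non-divisibility makes the bound strict, which lifts \<open>k\<close> from at
      least \<open>p div q\<close> to at least \<open>n\<close>.\<close>
    then have "p < k * q" using assms(4) by (metis dvd_triv_right le_neq_implies_less)
    then have "p div q < k" by (simp add: less_mult_imp_div_less)
    then show "enat n \<le> x" by (simp add: x n_def)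
  qed
  finally have chi: "chromatic_number (frac_power (circular_complete_graph p q) (s + 1) s)
    \<le> chromatic_number (circular_complete_graph p q)" .
  let ?\<rho> = "ereal (real (2 * (s + 1) + 1) / real (2 * s + 1))"
  have "3 \<le> odd_girth (circular_complete_graph p q)"
    by (rule odd_girth_ge_3) (use assms(2) in \<open>auto simp: circular_complete_graph_def\<close>)
  then have "ereal_of_enat 3 \<le> ereal_of_enat (odd_girth (circular_complete_graph p q))"
    by (simp only: ereal_of_enat_le_iff)
  moreover have "?\<rho> < ereal_of_enat 3"
    by (simp add: s_def numeral_eq_enat field_simps)
  ultimately have "?\<rho> < ereal_of_enat (odd_girth (circular_complete_graph p q))"
    by (rule order.strict_trans2[rotated])
  with chi have "?\<rho> \<le> theta (circular_complete_graph p q)"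
    unfolding theta_def by (intro Sup_upper) blast
  moreover have "1 < ?\<rho>" by (simp add: field_simps)
  ultimately show ?thesis by (rule order.strict_trans2[rotated])
qed

end
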